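(* Let $n\ge 1$ and $L\ge n+1$ be integers and let $0\le q\le p\le 1$ with $p>0$. In the system with $L$ sites and $n$ ordinary particles, for all $1\le i\le L-1$, $$\langle\!\langle\tau_i\rangle\!\rangle_{L,n}=\sum_{j=0}^{L-n-1}\sum_{k=0}^{j}\binom{L-1-i}{k}\binom{i-1}{j-k}p^kq^{j-k}\,\frac{\begin{Bmatrix}L-j-1\\ n\end{Bmatrix}_{p,q}}{\begin{Bmatrix}L\\ n+1\end{Bmatrix}_{p,q}},$$ $$\langle\!\langle\tau_{-i}\rangle\!\rangle_{L,n}=\sum_{j=0}^{L-n-1}\sum_{k=0}^{j}\binom{L-1-i}{k}\binom{i-1}{j-k}q^kp^{j-k}\,\frac{\begin{Bmatrix}L-j-1\\ n\end{Bmatrix}_{p,q}}{\begin{Bmatrix}L\\ n+1\end{Bmatrix}_{p,q}}.$$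
   Context: Configurations: $\Omega_{L,n}$ is the set of words $\eta$ of length $L$, with sites indexed by $\mathbb{Z}/L\mathbb{Z}$ and letters in $\{0,1,\hat 1\}$, containing exactly one $\hat 1$ (tracer particle), exactly $n$ letters $1$ (ordinary particles) and $L-n-1$ letters $0$ (vacancies). Dynamics: a continuous-time Markov chain on $\Omega_{L,n}$ in which, for each bond $(i,i+1)$ (mod $L$): $10\to 01$ at rate $1$, $01\to 10$ at rate $1$, $\hat 1 0\to 0\hat 1$ at rate $p$, $0\hat 1\to\hat 1 0$ at rate $q$; no other transitions occur. Steady state: for $L\ge n+2$, $\pi$ is the unique stationary distribution; for $L=n+1$ (no moves), $\pi$ is by convention uniform on $\Omega_{L,n}$. $\langle\cdot\rangle_{L,n}$ is expectation under $\pi$. $\sigma_i=1$ if $\eta_i=\hat 1$ and $0$ otherwise; $\tau_i=1$ if $\eta_i=1$ and $0$ otherwise. Environment process: $\langle\!\langle\cdot\rangle\!\rangle_{L,n}$ denotes steady state expectation when positions are measured relative to the tracer, which is placed at position $0$; position $-i$ is the same as $L-i$. Explicitly, for $i\not\equiv 0 \pmod L$, $\langle\!\langle\tau_i\rangle\!\rangle_{L,n}=\sum_{j\in\mathbb{Z}/L\mathbb{Z}}\langle\sigma_j\tau_{j+i}\rangle_{L,n}$. Restricted partition function: label sites $1,\dots,L$. For $\eta\in\Omega_{L,n}$ with $\eta_1=\hat 1$, $$w(\eta)=\prod_{\substack{2\le i\le L\\ \eta_i=0}}\bigl(1+p\,m_i(\eta)+q\,n_i(\eta)\bigr),$$ where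 $m_i(\eta)$ (resp. $n_i(\eta)$) is the number of $1$'s among $\eta_2,\dots,\eta_{i-1}$ (resp. $\eta_{i+1},\dots,\eta_L$), and $$\begin{Bmatrix}L\\ n+1\end{Bmatrix}_{p,q}=\sum_{\eta\in\Omega_{L,n},\ \eta_1=\hat 1}w(\eta)\qquad(0\le n\le L-1).$$ *)

theory Defs
  imports "HOL-Probability.Probability"
begin

datatype letter = Vacancy | Particle | Tracer

definition configs :: "nat \<Rightarrow> nat \<Rightarrow> letter list set" where
  "configs L n = {\<eta>. length \<eta> = L \<and> count_list \<eta> Tracer = 1
      \<and> count_list \<eta> Particle = n \<and> count_list \<eta> Vacancy = L - n - 1}"

(* Sites are the residues mod L; a word lists the letters at the sites 0, ..., L - 1.
   An arbitrary integer position is read modulo L. *)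
definition site :: "letter list \<Rightarrow> int \<Rightarrow> letter" where
  "site \<eta> i = \<eta> ! nat (i mod int (length \<eta>))"

(* The rate at which neighbouring letters a b (in this order) become b a. *)
fun exchange_rate :: "real \<Rightarrow> real \<Rightarrow> letter \<Rightarrow> letter \<Rightarrow> real" where
  "exchange_rate p q Particle Vacancy = 1"
| "exchange_rate p q Vacancy Particle = 1"
| "exchange_rate p q Tracer Vacancy = p"
| "exchange_rate p q Vacancy Tracer = q"
| "exchange_rate p q _ _ = 0"

definition swap_bond :: "letter list \<Rightarrow> nat \<Rightarrow> letter list" where
  "swap_bond \<eta> i = (let j = Suc i mod length \<eta> in \<eta>[i := \<eta> ! j, j := \<eta> ! i])"

definition jump_rate :: "real \<Rightarrow> real \<Rightarrow> letter list \<Rightarrow> letter list \<Rightarrow> real" where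
  "jump_rate p q \<eta> \<xi> = (\<Sum>i<length \<eta>.
     if swap_bond \<eta> i = \<xi> then exchange_rate p q (\<eta> ! i) (\<eta> ! (Suc i mod length \<eta>)) else 0)"

definition stationary :: "nat \<Rightarrow> nat \<Rightarrow> real \<Rightarrow> real \<Rightarrow> letter list pmf \<Rightarrow> bool" where
  "stationary L n p q \<pi> \<longleftrightarrow> set_pmf \<pi> \<subseteq> configs L n \<and>
     (\<forall>\<eta>\<in>configs L n.
        (\<Sum>\<xi>\<in>configs L n. pmf \<pi> \<xi> * jump_rate p q \<xi> \<eta>)
        = pmf \<pi> \<eta> * (\<Sum>\<xi>\<in>configs L n. jump_rate p q \<eta> \<xi>))"

(* Without vacancies nothing moves and every distribution is stationary; the uniform one is
   chosen by convention. *)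
definition steady_state :: "nat \<Rightarrow> nat \<Rightarrow> real \<Rightarrow> real \<Rightarrow> letter list pmf" where
  "steady_state L n p q =
     (if L = n + 1 then pmf_of_set (configs L n) else (THE \<pi>. stationary L n p q \<pi>))"

definition \<sigma> :: "int \<Rightarrow> letter list \<Rightarrow> real" where
  "\<sigma> i \<eta> = (if site \<eta> i = Tracer then 1 else 0)"

definition \<tau> :: "int \<Rightarrow> letter list \<Rightarrow> real" where
  "\<tau> i \<eta> = (if site \<eta> i = Particle then 1 else 0)"

(* The steady-state density of ordinary particles at position i relative to the tracer,
   for i not divisible by L. *)
definition env_density :: "nat \<Rightarrow> nat \<Rightarrow> real \<Rightarrow> real \<Rightarrow> int \<Rightarrow> real" where
  "env_density L n p q i = (\<Sum>j\<in>{0..<int L}.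
     measure_pmf.expectation (steady_state L n p q) (\<lambda>\<eta>. \<sigma> j \<eta> * \<tau> (j + i) \<eta>))"

(* In the weight the tracer sits at list index 0, the first site of the word. *)
definition weight :: "real \<Rightarrow> real \<Rightarrow> letter list \<Rightarrow> real" where
  "weight p q \<eta> = (\<Prod>i | 1 \<le> i \<and> i < length \<eta> \<and> \<eta> ! i = Vacancy.
     1 + p * real (card {k. 1 \<le> k \<and> k < i \<and> \<eta> ! k = Particle})
       + q * real (card {k. i < k \<and> k < length \<eta> \<and> \<eta> ! k = Particle}))"

(* The lower index r counts all particles, tracer included; only 1 \<le> r \<le> L is meaningful. *)
definition part_fun :: "real \<Rightarrow> real \<Rightarrow> nat \<Rightarrow> nat \<Rightarrow> real" where
  "part_fun p q L r = (\<Sum>\<eta> | \<eta> \<in> configs L (r - 1) \<and> \<eta> ! 0 = Tracer. weight p q \<eta>)"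

end

theory Submission
  imports Defs "HOL-Computational_Algebra.Polynomial"
begin

text \<open>Seen from the tracer, the vacancies perform a zero range process: a vacancy with \<open>m\<close>
  particles between the tracer and itself sits in box \<open>m\<close>, and its hops form a walk on the ring of
  \<open>n + 1\<close> boxes for which \<open>f m = 1 + p m + q (n - m)\<close> is invariant. So the product weight, rotated
  to the tracer, is stationary: in the balance equation the contributions of the bonds telescope.
  Any other stationary measure has a density with respect to it whose Dirichlet form vanishes, and
  the state space is connected.

  Deleting the particle at site \<open>i\<close> from a word turns \<open>f\<close> into the rate for \<open>n - 1\<close> particles plus
  \<open>q\<close> (vacancies before \<open>i\<close>) or plus \<open>p\<close> (vacancies after \<open>i\<close>). Expanding the product over these
  increments selects \<open>j\<close> vacancies, which may be deleted as well because vacancies do not influence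
  each other's rates; the number of ways to place them gives the binomial coefficients.\<close>

section \<open>Weighted sums over words\<close>

text \<open>The accumulator \<open>m\<close> counts the particles already passed, so reading a word
  from left to right gives each vacancy the rate of its box. A general \<open>f\<close> is kept so
  that the rates for \<open>n\<close> and for \<open>n - 1\<close> particles fit the same
  recursion.\<close>

primrec vac_weight :: "(nat \<Rightarrow> real) \<Rightarrow> nat \<Rightarrow> letter list \<Rightarrow> real" where
  "vac_weight f m [] = 1"
| "vac_weight f m (x # v) = (if x = Vacancy then f m else 1)
     * vac_weight f (if x = Particle then Suc m else m) v"

definition words :: "nat \<Rightarrow> nat \<Rightarrow> letter list set" where
  "words N r = {v. length v = N \<and> set v \<subseteq> {Vacancy, Particle} \<and> count_list v Particle = r}"

text \<open>This is the transfer recursion for a sum over words with \<open>r\<close> particles: a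
  vacancy at a position carries the box rate plus the entry of the list at that position. Constant
  entries 0 give back the plain sum of \<open>vac_weight\<close>; nonzero entries record what a
  deleted particle leaves behind.\<close>

primrec word_sum :: "(nat \<Rightarrow> real) \<Rightarrow> real list \<Rightarrow> nat \<Rightarrow> nat \<Rightarrow> real" where
  "word_sum f [] m r = (if r = 0 then 1 else 0)"
| "word_sum f (e # es) m r = (f m + e) * word_sum f es m r
     + (if r = 0 then 0 else word_sum f es (Suc m) (r - 1))"

lemma words_0: "words 0 r = (if r = 0 then {[]} else {})"
  by (auto simp: words_def)

lemma words_Suc:
  "words (Suc N) r = Cons Vacancy ` words N r \<union> (if r = 0 then {} else Cons Particle ` words N (r - 1))"
proof (intro set_eqI iffI)
  fix v assume "v \<in> words (Suc N) r"
  then show "v \<in> Cons Vacancy ` words N r \<union> (if r = 0 then {} else Cons Particle ` words N (r - 1))"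
    by (cases v) (auto simp: words_def split: if_splits)
qed (auto simp: words_def split: if_splits)

lemma finite_words: "finite (words N r)"
  by (induction N arbitrary: r) (auto simp: words_0 words_Suc)

lemma sum_words_Suc:
  fixes F :: "letter list \<Rightarrow> real"
  shows "sum F (words (Suc N) r) = (\<Sum>v\<in>words N r. F (Vacancy # v))
    + (if r = 0 then 0 else \<Sum>v\<in>words N (r - 1). F (Particle # v))"
proof -
  have "sum F (words (Suc N) r) = sum F (Cons Vacancy ` words N r)
      + sum F (if r = 0 then {} else Cons Particle ` words N (r - 1))"
    unfolding words_Suc by (intro sum.union_disjoint) (auto simp: finite_words)
  then show ?thesis
    by (simp add: sum.reindex)
qed

lemma sum_vac_weight: "(\<Sum>v\<in>words N r. vac_weight f m v) = word_sum f (replicate N 0) m r"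
  by (induction N arbitrary: m r) (simp_all add: words_0 sum_words_Suc flip: sum_distrib_left)

lemma word_sum_replicate_eq_0: "N < r \<Longrightarrow> word_sum f (replicate N e) m r = 0"
  by (induction N arbitrary: m r) auto

lemma word_sum_shift:
  assumes "\<And>k. f (Suc k) = f' k + y"
  shows "word_sum f (replicate N 0) (Suc m) r = word_sum f' (replicate N y) m r"
  by (induction N arbitrary: m r) (simp_all add: assms)

text \<open>The particle at position \<open>a\<close> is deleted. A vacancy to its left keeps its
  count, so its rate is \<open>f' k + x\<close>; one to its right had counted the deleted particle,
  so its rate is \<open>f (Suc k) = f' k + y\<close>.\<close>

lemma sum_particle_at:
  assumes "\<And>k. f k = f' k + x" and "\<And>k. f (Suc k) = f' k + y"
  shows "(\<Sum>v\<in>words (Suc (a + b)) (Suc r). of_bool (v ! a = Particle) * vac_weight f m v)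
    = word_sum f' (replicate a x @ replicate b y) m r"
proof (induction a arbitrary: m r)
  case 0
  then show ?case
    by (simp add: sum_words_Suc sum_vac_weight word_sum_shift[where f = f and f' = f' and y = y, OF assms(2)])
next
  case (Suc a)
  \<comment> \<open>For \<open>r = 0\<close>, a particle as first letter leaves words without
    particles, which the induction hypothesis does not cover; position \<open>a\<close> cannot carry
    a particle there.\<close>
  have z: "(\<Sum>v\<in>words (Suc (a + b)) 0. of_bool (v ! a = Particle) * vac_weight f (Suc m) v) = 0"
  proof (rule sum.neutral, safe)
    fix v assume "v \<in> words (Suc (a + b)) 0"
    then have "v ! a \<in> set v" "Particle \<notin> set v"
      by (auto simp: words_def count_list_0_iff)
    then have "v ! a \<noteq> Particle"
      by metis
    then show "of_bool (v ! a = Particle) * vac_weight f (Suc m) v = 0"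
      by simp
  qed
  have *: "(\<Sum>v\<in>words (Suc (a + b)) (Suc r). of_bool (v ! a = Particle) * (c * vac_weight f m v))
      = c * word_sum f' (replicate a x @ replicate b y) m r" for c r
    by (simp add: Suc.IH[symmetric] sum_distrib_left mult_ac)
  show ?case
    by (cases r) (use z in \<open>simp_all add: sum_words_Suc[of _ "Suc (a + b)"] Suc.IH * flip: assms(1)\<close>)
qed

text \<open>Expand every factor \<open>f m + e\<close>. A vacancy that contributes its increment
  \<open>e\<close> leaves the particle counts of all other letters unchanged, so it can be erased
  from the word. Choosing \<open>j\<close> such positions yields the elementary symmetric polynomial
  of the increments, which is the coefficient of degree \<open>j\<close> in the product of the
  factors \<open>1 + e X\<close>.\<close>

lemma word_sum_expand:
  "word_sum f es m r = (\<Sum>j\<le>length es. coeff (\<Prod>e\<leftarrow>es. [:1, e:]) j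
     * word_sum f (replicate (length es - j) 0) m r)"
proof (induction es arbitrary: m r)
  case Nil
  then show ?case by simp
next
  case (Cons e es)
  let ?l = "length es" and ?P = "\<Prod>e\<leftarrow>es. [:1, e:]"
  let ?Z = "\<lambda>N. word_sum f (replicate N 0)"
  \<comment> \<open>Lets the sum over \<open>j\<close> run one index further, matching the longer
    list \<open>e # es\<close>.\<close>
  have deg: "coeff ?P (Suc ?l) = 0"
  proof (rule coeff_eq_0)
    have "degree ?P \<le> length es"
    proof (induction es)
      case (Cons e es)
      have "degree ([:1, e:] * (\<Prod>e\<leftarrow>es. [:1, e:])) \<le> degree [:1, e:] + degree (\<Prod>e\<leftarrow>es. [:1, e:])"
        by (rule degree_mult_le)
      also have "\<dots> \<le> 1 + length es"
        using Cons by (intro add_mono) auto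
      finally show ?case by simp
    qed simp
    then show "degree ?P < Suc ?l" by simp
  qed
  have coeff: "coeff (\<Prod>e\<leftarrow>e # es. [:1, e:]) j
      = coeff ?P j + (if j = 0 then 0 else e * coeff ?P (j - 1))" for j
    by (cases j) simp_all
  have "word_sum f (e # es) m r
      = (\<Sum>j\<le>?l. coeff ?P j * (f m * ?Z (?l - j) m r + (if r = 0 then 0 else ?Z (?l - j) (Suc m) (r - 1))))
        + (\<Sum>j\<le>?l. e * coeff ?P j * ?Z (?l - j) m r)"
    unfolding word_sum.simps Cons.IH[of m r] Cons.IH[of "Suc m" "r - 1"]
    by (cases "r = 0") (simp_all add: algebra_simps sum.distrib sum_distrib_left)
  \<comment> \<open>The recursion of \<open>word_sum\<close> with increment 0, read backwards, glues
    the first letter onto the remaining word.\<close>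
  also have "(\<Sum>j\<le>?l. coeff ?P j * (f m * ?Z (?l - j) m r + (if r = 0 then 0 else ?Z (?l - j) (Suc m) (r - 1))))
      = (\<Sum>j\<le>?l. coeff ?P j * ?Z (Suc ?l - j) m r)"
    by (intro sum.cong) (auto simp: Suc_diff_le)
  also have "\<dots> = (\<Sum>j\<le>Suc ?l. coeff ?P j * ?Z (Suc ?l - j) m r)"
    by (simp add: deg)
  also have "(\<Sum>j\<le>?l. e * coeff ?P j * ?Z (?l - j) m r)
      = (\<Sum>j\<le>Suc ?l. (if j = 0 then 0 else e * coeff ?P (j - 1)) * ?Z (Suc ?l - j) m r)"
    by (subst sum.atMost_Suc_shift) simp
  finally show ?case
    unfolding coeff by (simp only: sum.distrib[symmetric] distrib_right list.size add_Suc_right add_0_right)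
qed

lemma coeff_one_plus_power: "coeff ([:1, x:] ^ N) k = real (N choose k) * x ^ k"
proof (induction N arbitrary: k)
  case 0
  then show ?case by (cases k) simp_all
next
  case (Suc N)
  then show ?case by (cases k) (simp_all add: algebra_simps)
qed

text \<open>With only two distinct increments the generating polynomial is a product of two binomial
  powers, and the Cauchy product of their coefficients gives the convolution: \<open>k\<close>
  erased vacancies from the right block, \<open>j - k\<close> from the left one.\<close>

lemma word_sum_two_blocks:
  "word_sum f (replicate a x @ replicate b y) m r
   = (\<Sum>j\<le>a + b. \<Sum>k\<le>j. real (b choose k) * real (a choose (j - k)) * y ^ k * x ^ (j - k)
       * word_sum f (replicate (a + b - j) 0) m r)"
proof -
  have "(\<Prod>e\<leftarrow>replicate a x @ replicate b y. [:1, e:]) = [:1, y:] ^ b * [:1, x:] ^ a"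
    by (simp add: prod_list_replicate)
  note * = this
  show ?thesis
    unfolding word_sum_expand[of _ "replicate a x @ replicate b y"] *
    unfolding coeff_mult coeff_one_plus_power sum_distrib_right length_append length_replicate
    by (intro sum.cong refl) (simp only: mult_ac)
qed

section \<open>Configurations and the weight seen from the tracer\<close>

text \<open>The subtraction is done in the reals, so the rate is affine in \<open>m\<close> with
  slope \<open>p - q\<close> for every \<open>m\<close>, without truncation beyond
  \<open>n\<close>.\<close>

definition vac_rate :: "real \<Rightarrow> real \<Rightarrow> nat \<Rightarrow> nat \<Rightarrow> real" where
  "vac_rate p q n m = 1 + p * real m + q * (real n - real m)"

lemma vac_weight_conv_prod:
  "vac_weight f m v
   = (\<Prod>i<length v. if v ! i = Vacancy then f (m + count_list (take i v) Particle) else 1)"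
  by (induction v arbitrary: m) (simp_all add: prod.lessThan_Suc_shift del: prod.lessThan_Suc cong: if_cong)

lemma vac_weight_append:
  "vac_weight f m (a @ b) = vac_weight f m a * vac_weight f (m + count_list a Particle) b"
  by (induction a arbitrary: m) simp_all

lemma count_list_conv_card: "count_list xs x = card {k. k < length xs \<and> xs ! k = x}"
  by (simp add: count_list_eq_length_filter length_filter_conv_card eq_commute)

text \<open>The number of particles to the right of a vacancy is \<open>n\<close> minus the number
  to its left, so the two-sided factor in \<open>weight\<close> depends on the left count
  alone.\<close>

lemma weight_Tracer_Cons:
  assumes "v \<in> words N n"
  shows "weight p q (Tracer # v) = vac_weight (vac_rate p q n) 0 v"
proof -
  let ?A = "{i. i < length v \<and> v ! i = Vacancy}"
  let ?c = "\<lambda>i. count_list (take i v) Particle"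
  have shift: "{i. 1 \<le> i \<and> i < length (Tracer # v) \<and> (Tracer # v) ! i = Vacancy} = Suc ` ?A"
    by (auto simp: image_iff gr0_conv_Suc nth_Cons' intro: Suc_pred[symmetric])
  have before: "card {k. 1 \<le> k \<and> k < Suc i \<and> (Tracer # v) ! k = Particle} = ?c i"
    if "i < length v" for i
  proof -
    have "{k. 1 \<le> k \<and> k < Suc i \<and> (Tracer # v) ! k = Particle}
        = Suc ` {k. k < length (take i v) \<and> take i v ! k = Particle}"
      using that by (auto simp: image_iff gr0_conv_Suc nth_Cons' intro: Suc_pred[symmetric])
    then show ?thesis
      by (simp add: card_image count_list_conv_card)
  qed
  have after: "card {k. Suc i < k \<and> k < length (Tracer # v) \<and> (Tracer # v) ! k = Particle} = n - ?c i"
    "?c i \<le> n" if "i \<in> ?A" for i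
  proof -
    let ?B = "{k. k < i \<and> v ! k = Particle}" and ?C = "{k. i < k \<and> k < length v \<and> v ! k = Particle}"
    have "{k. Suc i < k \<and> k < length (Tracer # v) \<and> (Tracer # v) ! k = Particle} = Suc ` ?C"
      by (auto simp: image_iff gr0_conv_Suc nth_Cons' intro: Suc_pred[symmetric])
    then have C: "card {k. Suc i < k \<and> k < length (Tracer # v) \<and> (Tracer # v) ! k = Particle} = card ?C"
      by (simp add: card_image)
    have "{k. k < length (take i v) \<and> take i v ! k = Particle} = ?B"
      using that by auto
    then have B: "?c i = card ?B"
      by (simp add: count_list_conv_card)
    have "{k. k < length v \<and> v ! k = Particle} = ?B \<union> ?C"
      using that by (auto simp: not_less_iff_gr_or_eq)
    moreover have "n = card {k. k < length v \<and> v ! k = Particle}"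
      using assms count_list_conv_card[of v Particle] by (auto simp: words_def)
    moreover have "card (?B \<union> ?C) = card ?B + card ?C"
      by (rule card_Un_disjoint) auto
    ultimately have "n = card ?B + card ?C"
      by simp
    with B C show "card {k. Suc i < k \<and> k < length (Tracer # v) \<and> (Tracer # v) ! k = Particle} = n - ?c i"
      "?c i \<le> n" by simp_all
  qed
  have factor: "1 + p * real (card {k. 1 \<le> k \<and> k < Suc i \<and> (Tracer # v) ! k = Particle})
      + q * real (card {k. Suc i < k \<and> k < length (Tracer # v) \<and> (Tracer # v) ! k = Particle})
      = vac_rate p q n (?c i)" if "i \<in> ?A" for i
    using that unfolding vac_rate_def after(1)[OF that] of_nat_diff[OF after(2)[OF that]]
    by (subst before) auto
  have "weight p q (Tracer # v) = (\<Prod>i\<in>?A. vac_rate p q n (?c i))"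
    unfolding weight_def shift prod.reindex[OF inj_Suc] o_def
    by (rule prod.cong[OF refl factor])
  also have "\<dots> = vac_weight (vac_rate p q n) 0 v"
    unfolding vac_weight_conv_prod
    by (subst prod.inter_filter[symmetric]) (auto intro!: prod.cong)
  finally show ?thesis .
qed

section \<open>Configurations as words split at the tracer\<close>

lemma length_conv_counts:
  "length \<eta> = count_list \<eta> Vacancy + count_list \<eta> Particle + count_list \<eta> Tracer"
proof (induction \<eta>)
  case (Cons x \<eta>)
  then show ?case by (cases x) simp_all
qed simp

lemma words_iff_counts:
  "v \<in> words N n \<longleftrightarrow> length v = N \<and> count_list v Tracer = 0 \<and> count_list v Particle = n"
proof -
  have "set v \<subseteq> {Vacancy, Particle} \<longleftrightarrow> Tracer \<notin> set v"
    using letter.exhaust by blast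
  then show ?thesis
    by (auto simp: words_def count_list_0_iff)
qed

lemma configs_iff:
  assumes "L \<ge> n + 1"
  shows "\<eta> \<in> configs L n \<longleftrightarrow> length \<eta> = L \<and> count_list \<eta> Tracer = 1 \<and> count_list \<eta> Particle = n"
  using length_conv_counts[of \<eta>] assms by (auto simp: configs_def)

lemma finite_configs: "finite (configs L n)"
proof (rule finite_subset)
  have "set \<eta> \<subseteq> {Vacancy, Particle, Tracer}" for \<eta>
    using letter.exhaust by blast
  then show "configs L n \<subseteq> {\<eta>. set \<eta> \<subseteq> {Vacancy, Particle, Tracer} \<and> length \<eta> = L}"
    by (auto simp: configs_def)
  show "finite {\<eta>. set \<eta> \<subseteq> {Vacancy, Particle, Tracer} \<and> length \<eta> = L}"
    by (rule finite_lists_length_eq) simp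
qed

lemma configs_Tracer_first:
  assumes "L \<ge> n + 1"
  shows "{\<eta> \<in> configs L n. \<eta> ! 0 = Tracer} = Cons Tracer ` words (L - 1) n"
proof (intro set_eqI iffI)
  fix \<eta> assume "\<eta> \<in> {\<eta> \<in> configs L n. \<eta> ! 0 = Tracer}"
  then show "\<eta> \<in> Cons Tracer ` words (L - 1) n"
    using assms by (cases \<eta>) (auto simp: configs_iff words_iff_counts)
qed (use assms in \<open>auto simp: configs_iff words_iff_counts\<close>)

lemma configs_splitE:
  assumes "\<eta> \<in> configs L n"
  obtains a b where "\<eta> = a @ Tracer # b" "Tracer \<notin> set a" "Tracer \<notin> set b"
proof -
  have "count_list \<eta> Tracer \<noteq> 0"
    using assms by (simp add: configs_def)
  then have "Tracer \<in> set \<eta>"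
    by (simp add: count_list_0_iff)
  then obtain a b where ab: "\<eta> = a @ Tracer # b" "Tracer \<notin> set a"
    by (auto dest: split_list_first)
  moreover have "Tracer \<notin> set b"
    using assms ab by (auto simp: configs_def count_list_0_iff)
  ultimately show thesis
    by (rule that)
qed

section \<open>Rotations of the ring\<close>

lemma count_list_mset_eq: "mset xs = mset ys \<Longrightarrow> count_list xs x = count_list ys x"
  by (metis count_mset)

lemma configs_mset_eq:
  assumes "mset \<xi> = mset \<eta>" "\<eta> \<in> configs L n"
  shows "\<xi> \<in> configs L n"
  using assms count_list_mset_eq[OF assms(1)] mset_eq_length[OF assms(1)] by (simp add: configs_def)

lemma rotate1_in_configs: "\<eta> \<in> configs L n \<Longrightarrow> rotate1 \<eta> \<in> configs L n"
  by (erule configs_mset_eq[rotated]) (cases \<eta>; simp)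

lemma rotate_in_configs: "\<eta> \<in> configs L n \<Longrightarrow> rotate k \<eta> \<in> configs L n"
  by (induction k) (simp_all add: rotate1_in_configs)

lemma length_configs: "\<eta> \<in> configs L n \<Longrightarrow> length \<eta> = L"
  by (simp add: configs_def)

lemma sum_configs_rotate:
  assumes "k < L"
  shows "(\<Sum>\<eta>\<in>configs L n. F (rotate k \<eta>)) = (\<Sum>\<eta>\<in>configs L n. F \<eta>)"
proof (rule sum.reindex_bij_witness[where i = "rotate (L - k)" and j = "rotate k"])
  fix \<eta> assume "\<eta> \<in> configs L n"
  moreover from this assms have "rotate (L - k + k) \<eta> = \<eta>" "rotate (k + (L - k)) \<eta> = \<eta>"
    by (simp_all add: length_configs)
  ultimately show "rotate (L - k) (rotate k \<eta>) = \<eta>" "rotate k (rotate (L - k) \<eta>) = \<eta>"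
    "rotate k \<eta> \<in> configs L n" "rotate (L - k) \<eta> \<in> configs L n"
    by (simp_all add: rotate_rotate rotate_in_configs del: le_add_diff_inverse le_add_diff_inverse2)
qed simp

lemma site_rotate:
  assumes "\<eta> \<noteq> []"
  shows "site (rotate k \<eta>) i = site \<eta> (int k + i)"
proof -
  have "nat (i mod int (length \<eta>)) < length \<eta>"
    using assms by (simp add: nat_less_iff)
  then have "site (rotate k \<eta>) i = \<eta> ! ((k + nat (i mod int (length \<eta>))) mod length \<eta>)"
    by (simp add: site_def nth_rotate)
  also have "(k + nat (i mod int (length \<eta>))) mod length \<eta> = nat ((int k + i) mod int (length \<eta>))"
  proof -
    have "int ((k + nat (i mod int (length \<eta>))) mod length \<eta>) = (int k + i) mod int (length \<eta>)"
      using assms by (simp add: zmod_int mod_add_right_eq)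
    then show ?thesis
      by linarith
  qed
  finally show ?thesis
    by (simp add: site_def)
qed

text \<open>The rotation-invariant extension of \<open>weight\<close> to all positions of the
  tracer: the word is turned until the tracer comes first, and the rest is weighed.\<close>

definition tracer_weight :: "real \<Rightarrow> real \<Rightarrow> nat \<Rightarrow> letter list \<Rightarrow> real" where
  "tracer_weight p q n \<eta> = vac_weight (vac_rate p q n) 0
     (tl (rotate (length (takeWhile (\<lambda>x. x \<noteq> Tracer) \<eta>)) \<eta>))"

lemma tracer_weight_split:
  assumes "Tracer \<notin> set a"
  shows "tracer_weight p q n (a @ Tracer # b) = vac_weight (vac_rate p q n) 0 (b @ a)"
proof -
  have "takeWhile (\<lambda>x. x \<noteq> Tracer) (a @ Tracer # b) = a"
    using assms by (subst takeWhile_append2) auto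
  then show ?thesis
    by (simp add: tracer_weight_def rotate_append)
qed

lemma tracer_weight_Cons: "tracer_weight p q n (Tracer # v) = vac_weight (vac_rate p q n) 0 v"
  using tracer_weight_split[of "[]"] by simp

lemma tracer_weight_rotate1:
  assumes "\<eta> \<in> configs L n"
  shows "tracer_weight p q n (rotate1 \<eta>) = tracer_weight p q n \<eta>"
proof -
  obtain a b where ab: "\<eta> = a @ Tracer # b" "Tracer \<notin> set a" "Tracer \<notin> set b"
    using assms by (rule configs_splitE)
  show ?thesis
  proof (cases a)
    case Nil
    then show ?thesis
      using ab tracer_weight_split[of b p q n "[]"] by (simp add: tracer_weight_Cons)
  next
    case (Cons x a')
    then show ?thesis
      using ab tracer_weight_split[of a' p q n "b @ [x]"] tracer_weight_split[of "x # a'" p q n b] by simp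
  qed
qed

lemma tracer_weight_rotate:
  "\<eta> \<in> configs L n \<Longrightarrow> tracer_weight p q n (rotate k \<eta>) = tracer_weight p q n \<eta>"
  by (induction k) (simp_all add: tracer_weight_rotate1[OF rotate_in_configs])

lemma vac_weight_pos: "(\<And>k. f k > 0) \<Longrightarrow> vac_weight f m v > 0"
  by (induction v arbitrary: m) simp_all

lemma vac_rate_pos:
  assumes "0 \<le> q" "q \<le> p"
  shows "vac_rate p q n m > 0"
proof -
  have "vac_rate p q n m = 1 + q * real n + (p - q) * real m"
    by (simp add: vac_rate_def algebra_simps)
  moreover have "q * real n \<ge> 0" "(p - q) * real m \<ge> 0"
    using assms by simp_all
  ultimately show ?thesis by linarith
qed

lemma tracer_weight_pos: "0 \<le> q \<Longrightarrow> q \<le> p \<Longrightarrow> tracer_weight p q n \<eta> > 0"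
  unfolding tracer_weight_def by (intro vac_weight_pos vac_rate_pos)

section \<open>Stationarity of the weight\<close>

lemma length_swap_bond [simp]: "length (swap_bond \<eta> i) = length \<eta>"
  by (simp add: swap_bond_def Let_def)

lemma Suc_mod_less: "i < L \<Longrightarrow> Suc i mod L < L"
  by (rule mod_less_divisor) simp

lemma swap_bond_swap_bond: "i < length \<eta> \<Longrightarrow> swap_bond (swap_bond \<eta> i) i = \<eta>"
  using Suc_mod_less[of i "length \<eta>"]
  by (intro nth_equalityI) (auto simp: swap_bond_def Let_def nth_list_update)

lemma swap_bond_nth:
  assumes "i < length \<eta>"
  shows "swap_bond \<eta> i ! i = \<eta> ! (Suc i mod length \<eta>)"
    and "swap_bond \<eta> i ! (Suc i mod length \<eta>) = \<eta> ! i"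
  using assms Suc_mod_less[OF assms] by (auto simp: swap_bond_def Let_def nth_list_update)

lemma swap_bond_in_configs:
  assumes "\<eta> \<in> configs L n" "i < L"
  shows "swap_bond \<eta> i \<in> configs L n"
proof (rule configs_mset_eq[OF _ assms(1)])
  have "i < length \<eta>" "Suc i mod length \<eta> < length \<eta>"
    using assms Suc_mod_less[of i L] by (auto simp: length_configs)
  then show "mset (swap_bond \<eta> i) = mset \<eta>"
    unfolding swap_bond_def Let_def by (rule mset_swap[rotated])
qed

lemma swap_bond_append:
  "swap_bond (a @ x # y # b) (length a) = a @ y # x # b"
  by (simp add: swap_bond_def list_update_append nth_append)

lemma swap_bond_wrap: "swap_bond (x # a @ [y]) (Suc (length a)) = y # a @ [x]"
  by (simp add: swap_bond_def list_update_append nth_append)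

lemma swap_bond_rotate1:
  assumes "i < length \<eta>"
  shows "swap_bond (rotate1 \<eta>) i = rotate1 (swap_bond \<eta> (Suc i mod length \<eta>))"
proof (rule nth_equalityI)
  fix k assume "k < length (swap_bond (rotate1 \<eta>) i)"
  then have k: "k < length \<eta>" by simp
  have eq: "Suc j mod length \<eta> = Suc k mod length \<eta> \<longleftrightarrow> j = k" if "j < length \<eta>" for j
    using k that by (auto simp: mod_Suc split: if_splits)
  show "swap_bond (rotate1 \<eta>) i ! k = rotate1 (swap_bond \<eta> (Suc i mod length \<eta>)) ! k"
    using k assms Suc_mod_less[OF k] Suc_mod_less[OF assms] eq[OF assms] eq[OF Suc_mod_less[OF assms]]
      Suc_mod_less[OF Suc_mod_less[OF assms]]
    by (simp add: nth_rotate1 swap_bond_def Let_def nth_list_update)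
qed simp

text \<open>Exchanging a vacancy and a particle changes only the factor of that vacancy, between
  \<open>f m\<close> and \<open>f m + d\<close>. The relative change is therefore a difference of
  the potential \<open>d / f\<close> evaluated at the boxes of the two sites, with value 0 on
  particles; two adjacent vacancies lie in the same box and cancel.\<close>

lemma telescoping_bond:
  assumes "\<And>k. f k > 0" and "\<And>k. f (Suc k) = f k + d"
    and "{x, y} \<subseteq> {Vacancy, Particle}" and "m = count_list a Particle"
  shows "(vac_weight f 0 (a @ y # x # b) - vac_weight f 0 (a @ x # y # b)) * of_bool (x \<noteq> y)
    = vac_weight f 0 (a @ x # y # b) * (of_bool (x = Vacancy) * d / f m
       - of_bool (y = Vacancy) * d / f (if x = Particle then Suc m else m))"
proof -
  have pos: "f m \<noteq> 0" "f m + d \<noteq> 0"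
    using assms(1)[of m] assms(1)[of "Suc m"] assms(2)[of m] by auto
  show ?thesis
    using assms(3) pos
    by (auto simp: vac_weight_append assms(2) field_simps simp flip: assms(4))
qed

text \<open>Net gain of probability at \<open>\<eta>\<close> through one bond. An exchange is an
  involution, so the only predecessor through bond \<open>i\<close> is
  \<open>swap_bond \<eta> i\<close>, which shows the two letters in the order \<open>y\<close>,
  \<open>x\<close>.\<close>

definition bond_flow :: "real \<Rightarrow> real \<Rightarrow> nat \<Rightarrow> letter list \<Rightarrow> nat \<Rightarrow> real" where
  "bond_flow p q n \<eta> i = (let x = \<eta> ! i; y = \<eta> ! (Suc i mod length \<eta>) in
     tracer_weight p q n (swap_bond \<eta> i) * exchange_rate p q y x
     - tracer_weight p q n \<eta> * exchange_rate p q x y)"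

lemma vac_rate_Suc: "vac_rate p q n (Suc m) = vac_rate p q n m + (p - q)"
  by (simp add: vac_rate_def algebra_simps)

lemma exchange_rate_words:
  "{x, y} \<subseteq> {Vacancy, Particle} \<Longrightarrow> exchange_rate p q x y = of_bool (x \<noteq> y)"
  by auto

text \<open>The bonds away from the tracer telescope to a difference of boundary potentials, and the
  two bonds at the tracer compensate the two ends separately.\<close>

lemma bond_flow_Tracer_first:
  assumes pq: "0 \<le> q" "q \<le> p" and v: "v \<in> words (Suc M) n"
  shows "(\<Sum>i<Suc (Suc M). bond_flow p q n (Tracer # v) i) = 0"
proof -
  define f where "f = vac_rate p q n"
  \<comment> \<open>The potential from \<open>telescoping_bond\<close>, with
    \<open>d = p - q\<close>.\<close>
  define g where "g i = of_bool (v ! i = Vacancy) * (p - q) / f (count_list (take i v) Particle)" for i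
  have f_pos: "f k > 0" for k
    unfolding f_def using pq by (rule vac_rate_pos)
  have f_Suc: "f (Suc k) = f k + (p - q)" for k
    by (simp add: f_def vac_rate_Suc)
  have f0: "f 0 = 1 + q * n" and fn: "f n = 1 + p * n"
    by (simp_all add: f_def vac_rate_def)
  have len: "length v = Suc M" and letters: "set v \<subseteq> {Vacancy, Particle}"
    and cnt: "count_list v Particle = n"
    using v by (auto simp: words_def)
  define W where "W = vac_weight f 0 v"
  have W: "tracer_weight p q n (Tracer # v) = W"
    by (simp add: tracer_weight_Cons W_def f_def)
  have inner: "bond_flow p q n (Tracer # v) (Suc i) = W * (g i - g (Suc i))" if "i < M" for i
  proof -
    define a b x y where "a = take i v" and "b = drop (Suc (Suc i)) v" and "x = v ! i" and "y = v ! Suc i"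
    have v_eq: "v = a @ x # y # b"
      unfolding a_def b_def x_def y_def using that len
      by (metis Cons_nth_drop_Suc Suc_less_eq append_take_drop_id less_SucI)
    have la: "length a = i"
      using that len by (simp add: a_def)
    have xy: "{x, y} \<subseteq> {Vacancy, Particle}"
      using letters v_eq by auto
    have sw: "swap_bond (Tracer # v) (Suc i) = Tracer # a @ y # x # b"
      using swap_bond_append[of "Tracer # a" x y b] v_eq la by simp
    have nth: "(Tracer # v) ! Suc i = x" "(Tracer # v) ! (Suc (Suc i) mod length (Tracer # v)) = y"
      using that len by (simp_all add: x_def y_def)
    have "bond_flow p q n (Tracer # v) (Suc i)
        = (vac_weight f 0 (a @ y # x # b) - vac_weight f 0 (a @ x # y # b)) * of_bool (x \<noteq> y)"
      unfolding bond_flow_def nth sw W Let_def using xy v_eq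
      by (simp add: tracer_weight_Cons exchange_rate_words W_def f_def eq_commute algebra_simps)
    also have "\<dots> = vac_weight f 0 (a @ x # y # b) * (of_bool (x = Vacancy) * (p - q) / f (count_list a Particle)
       - of_bool (y = Vacancy) * (p - q) / f (if x = Particle then Suc (count_list a Particle) else count_list a Particle))"
      by (rule telescoping_bond[where f = f and d = "p - q"]) (use f_pos f_Suc xy in auto)
    also have "\<dots> = W * (g i - g (Suc i))"
    proof -
      have "take (Suc i) v = a @ [x]"
        using v_eq la by simp
      then have "(if x = Particle then Suc (count_list a Particle) else count_list a Particle)
          = count_list (take (Suc i) v) Particle"
        by simp
      then show ?thesis
        unfolding g_def W_def by (simp add: v_eq[symmetric] flip: a_def x_def y_def)
    qed
    finally show ?thesis .
  qed
  \<comment> \<open>When the tracer and the vacancy in front of it are exchanged, the vacancy moves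
    from box 0 to box \<open>n\<close>, hence the ratio \<open>f n / f 0\<close>.\<close>
  have first: "bond_flow p q n (Tracer # v) 0 = W * (of_bool (v ! 0 = Vacancy) * (q * f n / f 0 - p))"
  proof -
    obtain x v' where v_eq: "v = x # v'"
      using len by (cases v) auto
    have sw: "swap_bond (Tracer # v) 0 = [x] @ Tracer # v'"
      using swap_bond_append[of "[]" Tracer x v'] v_eq by simp
    have x: "x = Vacancy \<or> x = Particle"
      using letters v_eq by auto
    have Wsw: "tracer_weight p q n ([x] @ Tracer # v') = vac_weight f 0 (v' @ [x])"
      using x unfolding f_def by (intro tracer_weight_split) auto
    have nth: "(Tracer # v) ! 0 = Tracer" "(Tracer # v) ! (Suc 0 mod length (Tracer # v)) = x"
      using len by (simp_all add: v_eq)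
    show ?thesis
      unfolding bond_flow_def nth sw W Let_def Wsw using x f_pos[of 0] cnt
      by (auto simp: v_eq W_def vac_weight_append field_simps)
  qed
  \<comment> \<open>The reverse passage, from box \<open>n\<close> to box 0, across the bond that
    closes the ring. A vacancy at the last site has all \<open>n\<close> particles before it, so its
    potential involves \<open>f n\<close>.\<close>
  have last: "bond_flow p q n (Tracer # v) (Suc M) = W * (of_bool (v ! M = Vacancy) * (p * f 0 / f n - q))"
    and g_last: "g M = of_bool (v ! M = Vacancy) * (p - q) / f n"
  proof -
    obtain y v' where v_eq: "v = v' @ [y]"
      using len by (cases v rule: rev_cases) auto
    have len': "length v' = M"
      using len v_eq by simp
    have sw: "swap_bond (Tracer # v) (Suc M) = (y # v') @ Tracer # []"
      using swap_bond_wrap[of Tracer v' y] v_eq len' by simp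
    have y: "y = Vacancy \<or> y = Particle" and y': "Tracer \<notin> set (y # v')"
      using letters v_eq by auto
    have Wsw: "tracer_weight p q n ((y # v') @ Tracer # []) = vac_weight f 0 (y # v')"
      using tracer_weight_split[OF y', of p q n "[]"] unfolding f_def by simp
    have nth: "(Tracer # v) ! Suc M = y" "(Tracer # v) ! (Suc (Suc M) mod length (Tracer # v)) = Tracer"
      "v ! M = y"
      using len' by (simp_all add: v_eq nth_append)
    show "bond_flow p q n (Tracer # v) (Suc M) = W * (of_bool (v ! M = Vacancy) * (p * f 0 / f n - q))"
      unfolding bond_flow_def nth sw W Let_def Wsw using y f_pos[of n] cnt
      by (auto simp: v_eq W_def vac_weight_append field_simps)
    show "g M = of_bool (v ! M = Vacancy) * (p - q) / f n"
      using y cnt len' unfolding g_def nth by (auto simp: v_eq)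
  qed
  have g_0: "g 0 = of_bool (v ! 0 = Vacancy) * (p - q) / f 0"
    by (simp add: g_def)
  have "(\<Sum>i<M. bond_flow p q n (Tracer # v) (Suc i)) = (\<Sum>i<M. W * (g i - g (Suc i)))"
    using inner by (intro sum.cong) auto
  also have "\<dots> = W * (g 0 - g M)"
    by (simp add: sum_lessThan_telescope' flip: sum_distrib_left)
  finally have "(\<Sum>i<Suc (Suc M). bond_flow p q n (Tracer # v) i)
      = W * (of_bool (v ! 0 = Vacancy) * (q * f n / f 0 - p + (p - q) / f 0)
          + of_bool (v ! M = Vacancy) * (p * f 0 / f n - q - (p - q) / f n))"
    by (subst sum.lessThan_Suc, subst sum.lessThan_Suc_shift)
      (simp add: first last g_0 g_last algebra_simps)
  \<comment> \<open>Both equations say \<open>p * f 0 = q * f n + (p - q)\<close>, which is where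
    the values \<open>1 + q n\<close> and \<open>1 + p n\<close> of the rate at the two end boxes
    enter.\<close>
  moreover have "q * f n / f 0 - p + (p - q) / f 0 = 0" "p * f 0 / f n - q - (p - q) / f n = 0"
    using f_pos[of 0] f_pos[of n] unfolding f0 fn by (simp_all add: field_simps)
  ultimately show ?thesis
    by simp
qed

lemma bij_betw_Suc_mod: "bij_betw (\<lambda>i. Suc i mod L) {..<L} {..<L}"
proof (rule bij_betw_imageI)
  show inj: "inj_on (\<lambda>i. Suc i mod L) {..<L}"
    by (rule inj_onI) (auto simp: mod_Suc split: if_splits)
  show "(\<lambda>i. Suc i mod L) ` {..<L} = {..<L}"
    by (rule endo_inj_surj[OF _ _ inj]) auto
qed

lemma bond_flow_rotate1:
  assumes \<eta>: "\<eta> \<in> configs L n"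
  shows "(\<Sum>i<L. bond_flow p q n (rotate1 \<eta>) i) = (\<Sum>i<L. bond_flow p q n \<eta> i)"
proof -
  have len: "length \<eta> = L"
    using \<eta> by (rule length_configs)
  have "bond_flow p q n (rotate1 \<eta>) i = bond_flow p q n \<eta> (Suc i mod L)" if "i < L" for i
  proof -
    have lt: "Suc i mod L < L" using that by (rule Suc_mod_less)
    show ?thesis
      using that len \<eta> lt tracer_weight_rotate1[OF swap_bond_in_configs[OF \<eta> lt], of p q]
      unfolding bond_flow_def by (simp add: swap_bond_rotate1 nth_rotate1 tracer_weight_rotate1)
  qed
  then have "(\<Sum>i<L. bond_flow p q n (rotate1 \<eta>) i) = (\<Sum>i<L. bond_flow p q n \<eta> (Suc i mod L))"
    by (intro sum.cong) auto
  also have "\<dots> = (\<Sum>i<L. bond_flow p q n \<eta> i)"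
    by (rule sum.reindex_bij_betw[OF bij_betw_Suc_mod])
  finally show ?thesis .
qed

text \<open>The total flow is invariant under rotation, so the tracer may be assumed to come
  first.\<close>

lemma bond_flow_balance:
  assumes pq: "0 \<le> q" "q \<le> p" and n: "n \<ge> 1" and L: "L \<ge> n + 1" and \<eta>: "\<eta> \<in> configs L n"
  shows "(\<Sum>i<L. bond_flow p q n \<eta> i) = 0"
proof -
  have rot: "(\<Sum>i<L. bond_flow p q n (rotate k \<eta>) i) = (\<Sum>i<L. bond_flow p q n \<eta> i)" for k
    by (induction k) (simp_all add: bond_flow_rotate1[OF rotate_in_configs[OF \<eta>]])
  obtain a b where ab: "\<eta> = a @ Tracer # b"
    using \<eta> by (rule configs_splitE)
  have r: "rotate (length a) \<eta> = Tracer # b @ a"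
    by (simp add: ab rotate_append)
  obtain M where M: "L = Suc (Suc M)"
    using n L by (cases L; cases "L - 1") auto
  have "b @ a \<in> words (Suc M) n"
    using \<eta>[unfolded configs_iff[OF L]] unfolding words_iff_counts ab M by simp
  then show ?thesis
    using bond_flow_Tracer_first[OF pq, of "b @ a" M n] rot[of "length a"] unfolding r M by simp
qed

section \<open>Uniqueness of the steady state\<close>

lemma count_list_replicate: "count_list (replicate k x) y = (if x = y then k else 0)"
  by (induction k) auto

lemma jump_rate_nonneg:
  assumes "0 \<le> p" "0 \<le> q"
  shows "jump_rate p q \<xi> \<eta> \<ge> 0"
proof -
  have "exchange_rate p q x y \<ge> 0" for x y
    using assms by (cases x; cases y) auto
  then show ?thesis
    unfolding jump_rate_def by (intro sum_nonneg) auto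
qed

text \<open>Several bonds may lead to the same word, as on a ring of two sites, but their rates only
  add up.\<close>

lemma jump_rate_swap_bond_pos:
  assumes "0 \<le> p" "0 \<le> q" "i < length \<xi>"
    and "exchange_rate p q (\<xi> ! i) (\<xi> ! (Suc i mod length \<xi>)) > 0"
  shows "jump_rate p q \<xi> (swap_bond \<xi> i) > 0"
proof -
  have "exchange_rate p q x y \<ge> 0" for x y
    using assms by (cases x; cases y) auto
  then show ?thesis
    unfolding jump_rate_def using assms by (intro sum_pos2[where i = i]) auto
qed

lemma jump_rate_configs:
  "\<xi> \<in> configs L n \<Longrightarrow> jump_rate p q \<xi> \<eta>
    = (\<Sum>i<L. if swap_bond \<xi> i = \<eta> then exchange_rate p q (\<xi> ! i) (\<xi> ! (Suc i mod L)) else 0)"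
  by (simp add: jump_rate_def length_configs cong: if_cong)

lemma sum_jump_rate_out:
  assumes \<eta>: "\<eta> \<in> configs L n"
  shows "(\<Sum>\<xi>\<in>configs L n. jump_rate p q \<eta> \<xi>)
    = (\<Sum>i<L. exchange_rate p q (\<eta> ! i) (\<eta> ! (Suc i mod L)))"
  unfolding jump_rate_configs[OF \<eta>]
  by (subst sum.swap) (simp add: finite_configs swap_bond_in_configs[OF \<eta>])

text \<open>Since exchanging a bond twice restores the word, each bond has exactly one source
  leading to \<open>\<eta>\<close>, namely \<open>swap_bond \<eta> i\<close>.\<close>

lemma sum_jump_rate_in:
  fixes F :: "letter list \<Rightarrow> real"
  assumes \<eta>: "\<eta> \<in> configs L n"
  shows "(\<Sum>\<xi>\<in>configs L n. F \<xi> * jump_rate p q \<xi> \<eta>)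
    = (\<Sum>i<L. F (swap_bond \<eta> i) * exchange_rate p q (\<eta> ! (Suc i mod L)) (\<eta> ! i))"
proof -
  have "(\<Sum>\<xi>\<in>configs L n. F \<xi> * jump_rate p q \<xi> \<eta>)
      = (\<Sum>\<xi>\<in>configs L n. \<Sum>i<L. if \<xi> = swap_bond \<eta> i
          then F \<xi> * exchange_rate p q (\<eta> ! (Suc i mod L)) (\<eta> ! i) else 0)"
  proof (rule sum.cong[OF refl])
    fix \<xi> assume \<xi>: "\<xi> \<in> configs L n"
    have "F \<xi> * jump_rate p q \<xi> \<eta> = (\<Sum>i<L. F \<xi> *
        (if swap_bond \<xi> i = \<eta> then exchange_rate p q (\<xi> ! i) (\<xi> ! (Suc i mod L)) else 0))"
      unfolding jump_rate_configs[OF \<xi>] by (rule sum_distrib_left)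
    also have "\<dots> = (\<Sum>i<L. if \<xi> = swap_bond \<eta> i
        then F \<xi> * exchange_rate p q (\<eta> ! (Suc i mod L)) (\<eta> ! i) else 0)"
    proof (rule sum.cong[OF refl])
      fix i assume "i \<in> {..<L}"
      then have i: "i < length \<xi>" "i < length \<eta>"
        using \<xi> \<eta> by (auto simp: length_configs)
      have "swap_bond \<xi> i = \<eta> \<longleftrightarrow> \<xi> = swap_bond \<eta> i"
        using swap_bond_swap_bond[OF i(1)] swap_bond_swap_bond[OF i(2)] by auto
      then show "F \<xi> * (if swap_bond \<xi> i = \<eta> then exchange_rate p q (\<xi> ! i) (\<xi> ! (Suc i mod L)) else 0)
          = (if \<xi> = swap_bond \<eta> i then F \<xi> * exchange_rate p q (\<eta> ! (Suc i mod L)) (\<eta> ! i) else 0)"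
        using swap_bond_nth[OF i(2)] length_configs[OF \<eta>] by simp
    qed
    finally show "F \<xi> * jump_rate p q \<xi> \<eta> = (\<Sum>i<L. if \<xi> = swap_bond \<eta> i
        then F \<xi> * exchange_rate p q (\<eta> ! (Suc i mod L)) (\<eta> ! i) else 0)" .
  qed
  also have "\<dots> = (\<Sum>i<L. F (swap_bond \<eta> i) * exchange_rate p q (\<eta> ! (Suc i mod L)) (\<eta> ! i))"
    by (subst sum.swap) (simp add: finite_configs swap_bond_in_configs[OF \<eta>])
  finally show ?thesis .
qed

lemma tracer_weight_stationary:
  assumes "0 \<le> q" "q \<le> p" "n \<ge> 1" "L \<ge> n + 1" and \<eta>: "\<eta> \<in> configs L n"
  shows "(\<Sum>\<xi>\<in>configs L n. tracer_weight p q n \<xi> * jump_rate p q \<xi> \<eta>)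
    = tracer_weight p q n \<eta> * (\<Sum>\<xi>\<in>configs L n. jump_rate p q \<eta> \<xi>)"
  using bond_flow_balance[OF assms]
  by (simp add: sum_jump_rate_in[OF \<eta>] sum_jump_rate_out[OF \<eta>] bond_flow_def Let_def
      length_configs[OF \<eta>] sum_subtractf sum_distrib_left)

section \<open>Connectivity of the state space\<close>

lemma vacancies_to_front:
  "mset (replicate (count_list \<xi> Vacancy) Vacancy @ filter (\<lambda>x. x \<noteq> Vacancy) \<xi>) = mset \<xi>"
  by (induction \<xi>) auto

lemma filter_no_Tracer:
  "Tracer \<notin> set a \<Longrightarrow> filter (\<lambda>x. x \<noteq> Vacancy) a = replicate (count_list a Particle) Particle"
proof (induction a)
  case (Cons x a)
  then show ?case by (cases x) auto
qed simp

text \<open>Vacancies can be moved past every letter, and carrying a particle around the ring through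
  the vacancies rotates the word of the remaining letters.\<close>

lemma configs_connected:
  assumes L: "L \<ge> n + 2"
    and bond: "\<And>\<xi> i. \<xi> \<in> configs L n \<Longrightarrow> i < L
      \<Longrightarrow> (\<xi> ! i = Vacancy) \<noteq> (\<xi> ! (Suc i mod L) = Vacancy) \<Longrightarrow> h (swap_bond \<xi> i) = h \<xi>"
    and \<eta>: "\<eta> \<in> configs L n"
  shows "h \<eta> = h (replicate (L - n - 1) Vacancy @ replicate n Particle @ [Tracer])"
proof -
  have adj: "h (a @ Vacancy # x # b) = h (a @ x # Vacancy # b)"
    if "a @ x # Vacancy # b \<in> configs L n" for a x b
  proof (cases "x = Vacancy")
    case False
    have "length (a @ x # Vacancy # b) = L"
      using that by (rule length_configs)
    then have "Suc (length a) < L"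
      by simp
    then show ?thesis
      using bond[OF that, of "length a"] False by (simp add: swap_bond_append nth_append)
  qed simp
  have wrap: "h (Vacancy # a @ [x]) = h (x # a @ [Vacancy])"
    if "x # a @ [Vacancy] \<in> configs L n" for a x
  proof (cases "x = Vacancy")
    case False
    have "length (x # a @ [Vacancy]) = L"
      using that by (rule length_configs)
    then have "L = Suc (Suc (length a))"
      by simp
    then show ?thesis
      using bond[OF that, of "Suc (length a)"] False by (simp add: swap_bond_wrap nth_append)
  qed simp
  have commute: "h (a @ x # replicate k Vacancy @ b) = h (a @ replicate k Vacancy @ x # b)"
    if "a @ x # replicate k Vacancy @ b \<in> configs L n" for a x k b
    using that
  proof (induction k arbitrary: a)
    case (Suc k)
    have "(a @ [Vacancy]) @ x # replicate k Vacancy @ b \<in> configs L n"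
      by (rule configs_mset_eq[OF _ Suc.prems]) simp
    from Suc.IH[OF this] adj[of a x "replicate k Vacancy @ b"] Suc.prems show ?case
      by simp
  qed simp
  \<comment> \<open>The free prefix \<open>a\<close> lets the induction step over a letter by
    appending it to the prefix.\<close>
  have front: "h (a @ \<xi>) = h (a @ replicate (count_list \<xi> Vacancy) Vacancy @ filter (\<lambda>x. x \<noteq> Vacancy) \<xi>)"
    if "a @ \<xi> \<in> configs L n" for a \<xi>
    using that
  proof (induction \<xi> arbitrary: a)
    case (Cons x \<xi>)
    let ?r = "replicate (count_list \<xi> Vacancy) Vacancy" and ?f = "filter (\<lambda>x. x \<noteq> Vacancy) \<xi>"
    have "a @ x # ?r @ ?f \<in> configs L n"
      using vacancies_to_front[of \<xi>] by (intro configs_mset_eq[OF _ Cons.prems]) simp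
    from commute[OF this] Cons.IH[of "a @ [x]"] Cons.prems show ?case
      by auto
  qed simp
  obtain M where M: "L - n - 1 = Suc M"
    using L by (cases "L - n - 1") auto
  \<comment> \<open>Normal forms: all vacancies in front, \<open>k\<close> particles before the
    tracer and \<open>l\<close> behind it. At least one vacancy is present because
    \<open>L \<ge> n + 2\<close>.\<close>
  let ?N = "\<lambda>k l. replicate (Suc M) Vacancy @ replicate k Particle @ Tracer # replicate l Particle"
  have N: "?N k l \<in> configs L n" if "k + l = n" for k l
    using that L M by (simp add: configs_def count_list_replicate)
  \<comment> \<open>The last particle trades places with the first vacancy across the closing bond;
    sorting the vacancies to the front again leaves that particle before the tracer.\<close>
  have step: "h (?N k (Suc l)) = h (?N (Suc k) l)" if "k + Suc l = n" for k l
  proof -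
    let ?u = "replicate M Vacancy @ replicate k Particle @ Tracer # replicate l Particle"
    have eq: "?N k (Suc l) = Vacancy # ?u @ [Particle]"
      by (simp add: replicate_append_same)
    have in_configs: "Particle # ?u @ [Vacancy] \<in> configs L n"
      by (rule configs_mset_eq[OF _ N[OF that]]) simp
    have "h (?N k (Suc l)) = h (Particle # ?u @ [Vacancy])"
      unfolding eq by (rule wrap[OF in_configs])
    also have "\<dots> = h (?N (Suc k) l)"
      using front[of "[]", simplified, OF in_configs] by (simp add: count_list_replicate)
    finally show ?thesis .
  qed
  have N_last: "h (?N k l) = h (?N n 0)" if "k + l = n" for k l
    using that
  proof (induction l arbitrary: k)
    case (Suc l)
    then show ?case
      using step[of k l] Suc.IH[of "Suc k"] by simp
  qed simp
  obtain a b where ab: "\<eta> = a @ Tracer # b" "Tracer \<notin> set a" "Tracer \<notin> set b"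
    using \<eta> by (rule configs_splitE)
  have counts: "count_list a Particle + count_list b Particle = n"
    "count_list \<eta> Vacancy = Suc M"
    using \<eta> ab(1) M by (auto simp: configs_def)
  have "h \<eta> = h (?N (count_list a Particle) (count_list b Particle))"
    using front[of "[]" \<eta>] \<eta> counts(2) by (simp add: ab filter_no_Tracer)
  also have "\<dots> = h (?N n 0)"
    by (rule N_last[OF counts(1)])
  finally show ?thesis
    unfolding M by simp
qed

text \<open>The Dirichlet form of the density \<open>h\<close> of one stationary measure with respect to another
  vanishes.\<close>

lemma stationary_density_const_on_edges:
  fixes r :: "'a \<Rightarrow> 'a \<Rightarrow> real"
  assumes fin: "finite C" and nonneg: "\<And>\<xi> \<eta>. r \<xi> \<eta> \<ge> 0" and pos: "\<And>\<xi>. w \<xi> > 0"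
    and w: "\<And>\<eta>. \<eta> \<in> C \<Longrightarrow> (\<Sum>\<xi>\<in>C. w \<xi> * r \<xi> \<eta>) = w \<eta> * (\<Sum>\<xi>\<in>C. r \<eta> \<xi>)"
    and hw: "\<And>\<eta>. \<eta> \<in> C \<Longrightarrow> (\<Sum>\<xi>\<in>C. h \<xi> * w \<xi> * r \<xi> \<eta>) = h \<eta> * w \<eta> * (\<Sum>\<xi>\<in>C. r \<eta> \<xi>)"
    and edge: "\<xi> \<in> C" "\<eta> \<in> C" "r \<xi> \<eta> > 0"
  shows "h \<xi> = h \<eta>"
proof -
  let ?R = "\<lambda>\<eta>. \<Sum>\<xi>\<in>C. r \<eta> \<xi>"
  let ?e = "\<lambda>\<xi> \<eta>. w \<xi> * r \<xi> \<eta> * (h \<xi> - h \<eta>)\<^sup>2"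
  \<comment> \<open>After expanding the square, each of the three double sums equals the sum of
    \<open>(h \<eta>)\<^sup>2 * (w \<eta> * ?R \<eta>)\<close>: one by the definition of the exit
    rate, one by stationarity of \<open>w\<close>, and the cross term by stationarity of
    \<open>h w\<close>. They enter with coefficients 1, 1 and -2.\<close>
  have "(\<Sum>\<xi>\<in>C. \<Sum>\<eta>\<in>C. ?e \<xi> \<eta>)
      = (\<Sum>\<xi>\<in>C. \<Sum>\<eta>\<in>C. w \<xi> * (h \<xi>)\<^sup>2 * r \<xi> \<eta>)
        + (\<Sum>\<xi>\<in>C. \<Sum>\<eta>\<in>C. (h \<eta>)\<^sup>2 * (w \<xi> * r \<xi> \<eta>))
        - 2 * (\<Sum>\<xi>\<in>C. \<Sum>\<eta>\<in>C. h \<eta> * (h \<xi> * w \<xi> * r \<xi> \<eta>))"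
    by (simp add: power2_diff algebra_simps sum.distrib sum_subtractf sum_distrib_left)
  also have "(\<Sum>\<xi>\<in>C. \<Sum>\<eta>\<in>C. (h \<eta>)\<^sup>2 * (w \<xi> * r \<xi> \<eta>)) = (\<Sum>\<eta>\<in>C. (h \<eta>)\<^sup>2 * (w \<eta> * ?R \<eta>))"
    by (subst sum.swap) (simp add: w flip: sum_distrib_left)
  also have "(\<Sum>\<xi>\<in>C. \<Sum>\<eta>\<in>C. h \<eta> * (h \<xi> * w \<xi> * r \<xi> \<eta>)) = (\<Sum>\<eta>\<in>C. h \<eta> * (h \<eta> * w \<eta> * ?R \<eta>))"
    by (subst sum.swap) (simp add: hw flip: sum_distrib_left)
  also have "(\<Sum>\<xi>\<in>C. \<Sum>\<eta>\<in>C. w \<xi> * (h \<xi>)\<^sup>2 * r \<xi> \<eta>) = (\<Sum>\<eta>\<in>C. (h \<eta>)\<^sup>2 * (w \<eta> * ?R \<eta>))"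
    by (intro sum.cong refl) (simp add: mult_ac sum_distrib_left)
  also have "(\<Sum>\<eta>\<in>C. h \<eta> * (h \<eta> * w \<eta> * ?R \<eta>)) = (\<Sum>\<eta>\<in>C. (h \<eta>)\<^sup>2 * (w \<eta> * ?R \<eta>))"
    by (simp add: power2_eq_square mult_ac)
  finally have zero: "(\<Sum>\<xi>\<in>C. \<Sum>\<eta>\<in>C. ?e \<xi> \<eta>) = 0"
    by simp
  have e: "?e \<xi> \<eta> \<ge> 0" for \<xi> \<eta>
    using nonneg pos by (simp add: less_imp_le)
  have "(\<Sum>\<eta>\<in>C. ?e \<xi> \<eta>) = 0"
    using zero edge(1) fin e by (subst (asm) sum_nonneg_eq_0_iff) (auto intro: sum_nonneg)
  then have "?e \<xi> \<eta> = 0"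
    using edge(2) fin e by (subst (asm) sum_nonneg_eq_0_iff) auto
  then show ?thesis
    using edge(3) pos[of \<xi>] by simp
qed

lemma stationary_proportional_tracer_weight:
  assumes pq: "0 \<le> q" "q \<le> p" "p > 0" and n: "n \<ge> 1" and L: "L \<ge> n + 2"
    and \<nu>: "stationary L n p q \<nu>"
  shows "\<exists>c. \<forall>\<eta>\<in>configs L n. pmf \<nu> \<eta> = c * tracer_weight p q n \<eta>"
proof -
  let ?w = "tracer_weight p q n"
  let ?h = "\<lambda>\<eta>. pmf \<nu> \<eta> / ?w \<eta>"
  have w_pos: "?w \<eta> > 0" for \<eta>
    using pq(1,2) by (rule tracer_weight_pos)
  then have hw: "?h \<eta> * ?w \<eta> = pmf \<nu> \<eta>" for \<eta>
    by (simp add: less_imp_neq[symmetric])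
  have edge: "?h \<xi> = ?h \<eta>" if "\<xi> \<in> configs L n" "\<eta> \<in> configs L n" "jump_rate p q \<xi> \<eta> > 0" for \<xi> \<eta>
  proof (rule stationary_density_const_on_edges[where r = "jump_rate p q" and w = ?w, OF finite_configs _ w_pos _ _ that])
    show "jump_rate p q \<xi> \<eta> \<ge> 0" for \<xi> \<eta>
      using pq by (intro jump_rate_nonneg) auto
    show "(\<Sum>\<xi>\<in>configs L n. ?w \<xi> * jump_rate p q \<xi> \<eta>) = ?w \<eta> * (\<Sum>\<xi>\<in>configs L n. jump_rate p q \<eta> \<xi>)"
      if "\<eta> \<in> configs L n" for \<eta>
      using pq n L that by (intro tracer_weight_stationary) auto
    show "(\<Sum>\<xi>\<in>configs L n. ?h \<xi> * ?w \<xi> * jump_rate p q \<xi> \<eta>)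
        = ?h \<eta> * ?w \<eta> * (\<Sum>\<xi>\<in>configs L n. jump_rate p q \<eta> \<xi>)" if "\<eta> \<in> configs L n" for \<eta>
      using \<nu> that unfolding hw stationary_def by blast
  qed
  have "?h (swap_bond \<xi> i) = ?h \<xi>"
    if \<xi>: "\<xi> \<in> configs L n" and i: "i < L" and vac: "(\<xi> ! i = Vacancy) \<noteq> (\<xi> ! (Suc i mod L) = Vacancy)" for \<xi> i
  proof -
    let ?x = "\<xi> ! i" and ?y = "\<xi> ! (Suc i mod L)"
    have len: "length \<xi> = L" and lt: "i < length \<xi>"
      using \<xi> i by (auto simp: length_configs)
    have sw: "swap_bond \<xi> i \<in> configs L n"
      using \<xi> i by (rule swap_bond_in_configs)
    have pq': "0 \<le> p" "0 \<le> q"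
      using pq by auto
    \<comment> \<open>For \<open>q = 0\<close> the tracer moves in one direction only, but equality
      of densities along a jump is symmetric, so one positive direction per bond suffices.\<close>
    consider "exchange_rate p q ?x ?y > 0" | "exchange_rate p q ?y ?x > 0"
      using vac pq by (cases ?x; cases ?y) auto
    then show ?thesis
    proof cases
      case 1
      then show ?thesis
        using edge[OF \<xi> sw] jump_rate_swap_bond_pos[OF pq' lt] len by simp
    next
      case 2
      then show ?thesis
        using edge[OF sw \<xi>] jump_rate_swap_bond_pos[OF pq', of i "swap_bond \<xi> i"] lt len
        by (simp add: swap_bond_nth[OF lt, unfolded len] swap_bond_swap_bond)
    qed
  qed
  then have "?h \<eta> = ?h (replicate (L - n - 1) Vacancy @ replicate n Particle @ [Tracer])"
    if "\<eta> \<in> configs L n" for \<eta>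
    by (rule configs_connected[OF L _ that])
  then show ?thesis
    using hw by metis
qed

section \<open>The steady state as the normalised tracer weight\<close>

lemma vac_weight_no_Vacancy: "Vacancy \<notin> set v \<Longrightarrow> vac_weight f m v = 1"
  by (induction v arbitrary: m) auto

lemma stationary_tracer_weight:
  assumes "0 \<le> q" "q \<le> p" "n \<ge> 1" "L \<ge> n + 1"
    and \<pi>: "\<And>\<eta>. pmf \<pi> \<eta> = (if \<eta> \<in> configs L n then c * tracer_weight p q n \<eta> else 0)"
  shows "stationary L n p q \<pi>"
  unfolding stationary_def
proof (intro conjI ballI)
  show "set_pmf \<pi> \<subseteq> configs L n"
    using \<pi> by (auto simp: set_pmf_iff split: if_splits)
  fix \<eta> assume "\<eta> \<in> configs L n"
  then show "(\<Sum>\<xi>\<in>configs L n. pmf \<pi> \<xi> * jump_rate p q \<xi> \<eta>)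
      = pmf \<pi> \<eta> * (\<Sum>\<xi>\<in>configs L n. jump_rate p q \<eta> \<xi>)"
    using tracer_weight_stationary[OF assms(1-4), of \<eta>]
    by (simp add: \<pi> mult.assoc flip: sum_distrib_left)
qed

lemma configs_nonempty:
  assumes "L \<ge> n + 1"
  shows "configs L n \<noteq> {}"
proof -
  have "Tracer # replicate n Particle @ replicate (L - n - 1) Vacancy \<in> configs L n"
    using assms by (simp add: configs_def count_list_replicate)
  then show ?thesis by blast
qed

lemma pmf_configs_unique:
  fixes w :: "letter list \<Rightarrow> real"
  assumes \<mu>: "set_pmf \<mu> \<subseteq> configs L n" and eq: "\<And>\<eta>. \<eta> \<in> configs L n \<Longrightarrow> pmf \<mu> \<eta> = c * w \<eta>"
  shows "pmf \<mu> \<eta> = (if \<eta> \<in> configs L n then w \<eta> / sum w (configs L n) else 0)"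
proof -
  have "1 = (\<Sum>\<eta>\<in>configs L n. pmf \<mu> \<eta>)"
    using \<mu> by (simp add: sum_pmf_eq_1 finite_configs)
  also have "\<dots> = c * sum w (configs L n)"
    by (simp add: eq sum_distrib_left)
  finally have c: "c = 1 / sum w (configs L n)"
    by (cases "sum w (configs L n) = 0") (simp_all add: field_simps)
  show ?thesis
    using \<mu> eq[of \<eta>] by (auto simp: c set_pmf_iff)
qed

text \<open>For \<open>L \<ge> n + 2\<close> the normalised weight is stationary, and every
  stationary measure is proportional to it, which resolves the definite description. For
  \<open>L = n + 1\<close> the conventional uniform measure has the same form.\<close>

lemma pmf_steady_state:
  assumes pq: "0 \<le> q" "q \<le> p" "p > 0" and n: "n \<ge> 1" and L: "L \<ge> n + 1"
  shows "pmf (steady_state L n p q) \<eta> = (if \<eta> \<in> configs L n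
    then tracer_weight p q n \<eta> / sum (tracer_weight p q n) (configs L n) else 0)"
proof (cases "L = n + 1")
  case True
  have fin: "finite (configs L n)" and ne: "configs L n \<noteq> {}"
    using L by (auto simp: finite_configs configs_nonempty)
  have steady: "steady_state L n p q = pmf_of_set (configs L n)"
    by (simp add: steady_state_def True)
  \<comment> \<open>Without vacancies the weight is an empty product.\<close>
  have "tracer_weight p q n \<eta> = 1" if \<eta>: "\<eta> \<in> configs L n" for \<eta>
  proof -
    obtain a b where ab: "\<eta> = a @ Tracer # b" "Tracer \<notin> set a" "Tracer \<notin> set b"
      using \<eta> by (rule configs_splitE)
    have "Vacancy \<notin> set (b @ a)"
      using \<eta> True ab(1) by (auto simp: configs_def count_list_0_iff)
    then show ?thesis
      using ab by (simp add: tracer_weight_split vac_weight_no_Vacancy)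
  qed
  then show ?thesis
    unfolding steady using fin ne by (intro pmf_configs_unique[where c = "1 / card (configs L n)"]) auto
next
  case False
  then have L2: "L \<ge> n + 2"
    using L by simp
  let ?w = "tracer_weight p q n"
  let ?S = "sum ?w (configs L n)"
  let ?f = "\<lambda>\<eta>. if \<eta> \<in> configs L n then ?w \<eta> / ?S else 0"
  have S: "?S > 0"
    using L pq by (intro sum_pos finite_configs configs_nonempty tracer_weight_pos)
  have w: "?w \<eta> \<ge> 0" for \<eta>
    using tracer_weight_pos[OF pq(1,2)] by (simp add: less_imp_le)
  have f: "pmf (embed_pmf ?f) \<eta> = ?f \<eta>" for \<eta>
  proof (rule pmf_embed_pmf)
    show "?f \<eta> \<ge> 0" for \<eta>
      using S w by simp
    have "(\<integral>\<^sup>+ \<eta>. ennreal (?f \<eta>) \<partial>count_space UNIV) = (\<Sum>\<eta>\<in>configs L n. ennreal (?f \<eta>))"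
      by (rule nn_integral_count_space') (auto simp: finite_configs)
    also have "\<dots> = ennreal (\<Sum>\<eta>\<in>configs L n. ?w \<eta> / ?S)"
      using S w by (simp add: sum_ennreal)
    also have "(\<Sum>\<eta>\<in>configs L n. ?w \<eta> / ?S) = 1"
      using S by (simp flip: sum_divide_distrib)
    finally show "(\<integral>\<^sup>+ \<eta>. ennreal (?f \<eta>) \<partial>count_space UNIV) = 1"
      by simp
  qed
  have "stationary L n p q (embed_pmf ?f)"
    using pq n L f by (intro stationary_tracer_weight[where c = "1 / ?S"]) auto
  moreover have "\<nu> = embed_pmf ?f" if \<nu>: "stationary L n p q \<nu>" for \<nu>
  proof (rule pmf_eqI)
    fix \<eta>
    obtain c where "\<And>\<eta>. \<eta> \<in> configs L n \<Longrightarrow> pmf \<nu> \<eta> = c * ?w \<eta>"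
      using stationary_proportional_tracer_weight[OF pq n L2 \<nu>] by blast
    then show "pmf \<nu> \<eta> = pmf (embed_pmf ?f) \<eta>"
      unfolding f using \<nu> by (intro pmf_configs_unique) (auto simp: stationary_def)
  qed
  ultimately have "(THE \<pi>. stationary L n p q \<pi>) = embed_pmf ?f"
    by (rule the_equality)
  then show ?thesis
    using False f by (simp add: steady_state_def)
qed

section \<open>Densities in the environment process\<close>

text \<open>Rotating by \<open>j\<close> brings the tracer from site \<open>j\<close> to the first
  site, so every tracer position yields the same sum over words.\<close>

lemma sum_configs_Tracer_at:
  fixes F :: "letter list \<Rightarrow> real"
  assumes L: "L \<ge> n + 1" and j: "j < L"
  shows "(\<Sum>\<eta>\<in>configs L n. F (rotate j \<eta>) * \<sigma> (int j) \<eta>) = (\<Sum>v\<in>words (L - 1) n. F (Tracer # v))"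
proof -
  have ne: "\<eta> \<noteq> []" if "\<eta> \<in> configs L n" for \<eta>
    using that L by (auto simp: configs_def)
  have "(\<Sum>\<eta>\<in>configs L n. F (rotate j \<eta>) * \<sigma> (int j) \<eta>)
      = (\<Sum>\<eta>\<in>configs L n. (\<lambda>\<eta>. F \<eta> * \<sigma> 0 \<eta>) (rotate j \<eta>))"
    by (intro sum.cong refl) (simp add: \<sigma>_def site_rotate ne)
  also have "\<dots> = (\<Sum>\<eta>\<in>configs L n. F \<eta> * \<sigma> 0 \<eta>)"
    by (rule sum_configs_rotate[OF j])
  also have "\<dots> = (\<Sum>\<eta> | \<eta> \<in> configs L n \<and> \<eta> ! 0 = Tracer. F \<eta>)"
    by (rule sum.mono_neutral_cong_right) (auto simp: finite_configs \<sigma>_def site_def)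
  also have "\<dots> = (\<Sum>v\<in>words (L - 1) n. F (Tracer # v))"
    using configs_Tracer_first[OF L] by (simp add: sum.reindex)
  finally show ?thesis .
qed

lemma part_fun_eq_word_sum:
  assumes "L \<ge> n + 1"
  shows "part_fun p q L (n + 1) = word_sum (vac_rate p q n) (replicate (L - 1) 0) 0 n"
  using configs_Tracer_first[OF assms]
  by (simp add: part_fun_def sum.reindex weight_Tracer_Cons flip: sum_vac_weight)

text \<open>Insert 1 as the sum of \<open>\<sigma> (int j) \<eta>\<close> over all sites, since
  there is exactly one tracer; each of the \<open>L\<close> positions then contributes one
  restricted partition function.\<close>

lemma sum_tracer_weight:
  assumes L: "L \<ge> n + 1"
  shows "sum (tracer_weight p q n) (configs L n) = real L * part_fun p q L (n + 1)"
proof -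
  have one: "(\<Sum>j<L. \<sigma> (int j) \<eta>) = 1" if \<eta>: "\<eta> \<in> configs L n" for \<eta>
  proof -
    have "(\<Sum>j<L. \<sigma> (int j) \<eta>) = (\<Sum>j<L. of_bool (\<eta> ! j = Tracer))"
      using \<eta> by (intro sum.cong) (auto simp: \<sigma>_def site_def length_configs nat_mod_as_int[symmetric])
    also have "\<dots> = real (card {j. j < L \<and> \<eta> ! j = Tracer})"
      by (simp add: sum.If_cases of_bool_def Int_def)
    also have "card {j. j < L \<and> \<eta> ! j = Tracer} = count_list \<eta> Tracer"
      by (simp add: count_list_conv_card length_configs[OF \<eta>])
    also have "real (count_list \<eta> Tracer) = 1"
      using \<eta> by (simp add: configs_def)
    finally show ?thesis .
  qed
  have "sum (tracer_weight p q n) (configs L n)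
      = (\<Sum>\<eta>\<in>configs L n. \<Sum>j<L. tracer_weight p q n (rotate j \<eta>) * \<sigma> (int j) \<eta>)"
    by (intro sum.cong refl) (simp add: tracer_weight_rotate one flip: sum_distrib_left)
  also have "\<dots> = (\<Sum>j<L. \<Sum>v\<in>words (L - 1) n. tracer_weight p q n (Tracer # v))"
    by (subst sum.swap) (simp add: sum_configs_Tracer_at[OF L])
  also have "\<dots> = real L * part_fun p q L (n + 1)"
    unfolding part_fun_eq_word_sum[OF L] by (simp add: tracer_weight_Cons sum_vac_weight)
  finally show ?thesis .
qed

text \<open>The sum over tracer positions produces a factor \<open>L\<close> that cancels the one in
  the normalisation. Here \<open>a\<close> and \<open>b\<close> are the numbers of sites before and
  after the observed site, read from the tracer around the ring, which treats positive and negative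
  positions alike.\<close>

lemma env_density_eq:
  assumes pq: "0 \<le> q" "q \<le> p" "p > 0" and n: "n \<ge> 1" and L: "L \<ge> n + 1"
    and s: "s mod int L = int (Suc a)" and ab: "L = Suc (Suc (a + b))"
  shows "env_density L n p q s
    = word_sum (vac_rate p q (n - 1)) (replicate a q @ replicate b p) 0 (n - 1) / part_fun p q L (n + 1)"
proof -
  let ?w = "tracer_weight p q n" and ?Z = "part_fun p q L (n + 1)"
  let ?\<pi> = "steady_state L n p q"
  let ?F = "\<lambda>\<eta>. ?w \<eta> / (real L * ?Z) * \<tau> s \<eta>"
  obtain r where r: "n = Suc r"
    using n by (cases n) auto
  have ne: "\<eta> \<noteq> []" if "\<eta> \<in> configs L n" for \<eta>
    using that L by (auto simp: configs_def)
  have exp: "measure_pmf.expectation ?\<pi> (\<lambda>\<eta>. \<sigma> (int j) \<eta> * \<tau> (int j + s) \<eta>)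
      = (\<Sum>v\<in>words (L - 1) n. ?F (Tracer # v))" if j: "j < L" for j
  proof -
    have "set_pmf ?\<pi> \<subseteq> configs L n"
      using pmf_steady_state[OF pq n L] by (auto simp: set_pmf_iff split: if_splits)
    then have "measure_pmf.expectation ?\<pi> (\<lambda>\<eta>. \<sigma> (int j) \<eta> * \<tau> (int j + s) \<eta>)
        = (\<Sum>\<eta>\<in>configs L n. \<sigma> (int j) \<eta> * \<tau> (int j + s) \<eta> * pmf ?\<pi> \<eta>)"
      by (intro integral_measure_pmf_real finite_configs) auto
    also have "\<dots> = (\<Sum>\<eta>\<in>configs L n. ?F (rotate j \<eta>) * \<sigma> (int j) \<eta>)"
      by (intro sum.cong refl)
        (simp add: pmf_steady_state[OF pq n L] sum_tracer_weight[OF L] tracer_weight_rotate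
          \<tau>_def site_rotate ne)
    also have "\<dots> = (\<Sum>v\<in>words (L - 1) n. ?F (Tracer # v))"
      by (rule sum_configs_Tracer_at[OF L j])
    finally show ?thesis .
  qed
  have "env_density L n p q s
      = (\<Sum>j<L. measure_pmf.expectation ?\<pi> (\<lambda>\<eta>. \<sigma> (int j) \<eta> * \<tau> (int j + s) \<eta>))"
    unfolding env_density_def
    by (rule sum.reindex_bij_witness[where i = int and j = nat]) auto
  also have "\<dots> = real L * (\<Sum>v\<in>words (L - 1) n. ?F (Tracer # v))"
    using exp by simp
  also have "\<dots> = (\<Sum>v\<in>words (L - 1) n. of_bool (v ! a = Particle) * vac_weight (vac_rate p q n) 0 v) / ?Z"
  proof -
    have "\<tau> s (Tracer # v) = of_bool (v ! a = Particle)" if "v \<in> words (L - 1) n" for v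
    proof -
      have "length (Tracer # v) = L"
        using that ab by (simp add: words_def)
      then show ?thesis
        unfolding \<tau>_def site_def by (simp only: s nat_int nth_Cons_Suc) simp
    qed
    then show ?thesis
      unfolding sum_distrib_left sum_divide_distrib using L
      by (intro sum.cong refl) (simp add: tracer_weight_Cons)
  qed
  \<comment> \<open>Deleting the observed particle: the rate for \<open>n\<close> particles at
    \<open>k\<close> is that for \<open>n - 1\<close> at \<open>k\<close> plus \<open>q\<close>, and
    at \<open>Suc k\<close> it is that same rate plus \<open>p\<close>.\<close>
  also have "(\<Sum>v\<in>words (L - 1) n. of_bool (v ! a = Particle) * vac_weight (vac_rate p q n) 0 v)
      = word_sum (vac_rate p q r) (replicate a q @ replicate b p) 0 r"
  proof -
    have "L - 1 = Suc (a + b)"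
      using ab by simp
    then show ?thesis
      unfolding r by (simp only:) (rule sum_particle_at; simp add: vac_rate_def algebra_simps)
  qed
  finally show ?thesis
    by (simp add: r)
qed

lemma word_sum_two_blocks_part_fun:
  assumes n: "n \<ge> 1" and L: "L \<ge> n + 1" and ab: "L = Suc (Suc (a + b))"
  shows "word_sum (vac_rate p q (n - 1)) (replicate a q @ replicate b p) 0 (n - 1)
    = (\<Sum>j = 0..L - n - 1. \<Sum>k = 0..j. real (b choose k) * real (a choose (j - k)) * p ^ k * q ^ (j - k)
        * part_fun p q (L - j - 1) n)"
proof -
  let ?t = "\<lambda>j. \<Sum>k\<le>j. real (b choose k) * real (a choose (j - k)) * p ^ k * q ^ (j - k)
    * word_sum (vac_rate p q (n - 1)) (replicate (a + b - j) 0) 0 (n - 1)"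
  \<comment> \<open>Once \<open>j > L - n - 1\<close>, fewer than \<open>n - 1\<close> letters
    remain, too few for the remaining \<open>n - 1\<close> particles, so the terms vanish.\<close>
  have "(\<Sum>j\<le>a + b. ?t j) = (\<Sum>j = 0..L - n - 1. ?t j)"
  proof (rule sum.mono_neutral_right)
    show "{0..L - n - 1} \<subseteq> {..a + b}"
      using n ab by auto
    show "\<forall>j\<in>{..a + b} - {0..L - n - 1}. ?t j = 0"
      using n L ab by (auto simp: word_sum_replicate_eq_0)
  qed simp
  also have "\<dots> = (\<Sum>j = 0..L - n - 1. \<Sum>k = 0..j. real (b choose k) * real (a choose (j - k))
      * p ^ k * q ^ (j - k) * part_fun p q (L - j - 1) n)"
  proof (rule sum.cong[OF refl])
    fix j assume "j \<in> {0..L - n - 1}"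
    then have "part_fun p q (L - j - 1) n
        = word_sum (vac_rate p q (n - 1)) (replicate (a + b - j) 0) 0 (n - 1)"
      using part_fun_eq_word_sum[of "n - 1" "L - j - 1" p q] n L ab by simp
    then show "?t j = (\<Sum>k = 0..j. real (b choose k) * real (a choose (j - k))
        * p ^ k * q ^ (j - k) * part_fun p q (L - j - 1) n)"
      by (simp add: atMost_atLeast0)
  qed
  finally show ?thesis
    by (simp add: word_sum_two_blocks)
qed

theorem theorem2p9:
  fixes L n i :: nat and p q :: real
  assumes "n \<ge> 1" and "L \<ge> n + 1"
    and "0 \<le> q" and "q \<le> p" and "p \<le> 1" and "p > 0"
    and "1 \<le> i" and "i \<le> L - 1"
  shows "env_density L n p q (int i) =
           (\<Sum>j = 0..L - n - 1. \<Sum>k = 0..j.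
              real ((L - 1 - i) choose k) * real ((i - 1) choose (j - k)) * p ^ k * q ^ (j - k)
              * (part_fun p q (L - j - 1) n / part_fun p q L (n + 1)))
       \<and> env_density L n p q (- int i) =
           (\<Sum>j = 0..L - n - 1. \<Sum>k = 0..j.
              real ((L - 1 - i) choose k) * real ((i - 1) choose (j - k)) * q ^ k * p ^ (j - k)
              * (part_fun p q (L - j - 1) n / part_fun p q L (n + 1)))"
proof
  have L: "L = Suc (Suc ((i - 1) + (L - 1 - i)))" "L = Suc (Suc ((L - 1 - i) + (i - 1)))"
    using assms by auto
  have "int i mod int L = int (Suc (i - 1))"
    using assms by simp
  from env_density_eq[OF assms(3,4,6,1,2) this L(1)]
  show "env_density L n p q (int i) =
           (\<Sum>j = 0..L - n - 1. \<Sum>k = 0..j.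
              real ((L - 1 - i) choose k) * real ((i - 1) choose (j - k)) * p ^ k * q ^ (j - k)
              * (part_fun p q (L - j - 1) n / part_fun p q L (n + 1)))"
    unfolding word_sum_two_blocks_part_fun[OF assms(1,2) L(1)]
    by (simp add: sum_divide_distrib)
  \<comment> \<open>Position \<open>-i\<close> is site \<open>L - i\<close>, so the block sizes
    before and after the observed site are interchanged.\<close>
  have "- int i mod int L = int (Suc (L - 1 - i))"
  proof -
    have "- int i mod int L = (int L - int i) mod int L"
      by simp
    also have "\<dots> = int L - int i"
      using assms by (intro mod_pos_pos_trivial) auto
    finally show ?thesis
      using assms by auto
  qed
  from env_density_eq[OF assms(3,4,6,1,2) this L(2)]
  have "env_density L n p q (- int i) = (\<Sum>j = 0..L - n - 1. \<Sum>k = 0..j.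
      real ((i - 1) choose k) * real ((L - 1 - i) choose (j - k)) * p ^ k * q ^ (j - k)
        * (part_fun p q (L - j - 1) n / part_fun p q L (n + 1)))"
    unfolding word_sum_two_blocks_part_fun[OF assms(1,2) L(2)]
    by (simp add: sum_divide_distrib)
  also have "\<dots> = (\<Sum>j = 0..L - n - 1. \<Sum>k = 0..j.
      real ((L - 1 - i) choose k) * real ((i - 1) choose (j - k)) * q ^ k * p ^ (j - k)
        * (part_fun p q (L - j - 1) n / part_fun p q L (n + 1)))"
  \<comment> \<open>Reflecting \<open>k\<close> to \<open>j - k\<close> restores the stated order of
    the binomial coefficients and exchanges the powers of \<open>p\<close> and
    \<open>q\<close>.\<close>
  proof (rule sum.cong[OF refl])
    fix j
    show "(\<Sum>k = 0..j. real ((i - 1) choose k) * real ((L - 1 - i) choose (j - k)) * p ^ k * q ^ (j - k)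
        * (part_fun p q (L - j - 1) n / part_fun p q L (n + 1)))
      = (\<Sum>k = 0..j. real ((L - 1 - i) choose k) * real ((i - 1) choose (j - k)) * q ^ k * p ^ (j - k)
        * (part_fun p q (L - j - 1) n / part_fun p q L (n + 1)))"
      by (rule sum.reindex_bij_witness[where i = "\<lambda>k. j - k" and j = "\<lambda>k. j - k"]) (auto simp: mult_ac)
  qed
  finally show "env_density L n p q (- int i) =
           (\<Sum>j = 0..L - n - 1. \<Sum>k = 0..j.
              real ((L - 1 - i) choose k) * real ((i - 1) choose (j - k)) * q ^ k * p ^ (j - k)
              * (part_fun p q (L - j - 1) n / part_fun p q L (n + 1)))" .
qed

end
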